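(* Let $\widehat g:\mathbb{C}\to\mathbb{C}$ be a function, let $g\in\mathbb{C}^N$ be the associated signal, let $J$ be a finite subset of $\mathbb{R}^{+}$, and let $\alpha,\beta>0$. Then the spectral graph wavelet system $\{T_i D_s g : 1\le i\le N,\ s\in J\}$ is a frame for $\mathbb{C}^N$ with frame bounds $\alpha$ and $\beta$ if and only if $$\frac{\alpha}{N}\le \sum_{s\in J}|\widehat g(s\lambda_l)|^2\le\frac{\beta}{N}\quad\text{for all } l\in\{1,\dots,N\}.$$
   Context: Let $G$ be an undirected, connected, weighted graph with vertex set $\mathcal V=\{1,\dots,N\}$, and let $A$ be an $N\times N$ diagonalizable matrix associated with $G$ (for example its adjacency matrix or its graph Laplacian), with eigenvalues $\lambda_1,\dots,\lambda_N$ (listed with multiplicity) and corresponding eigenvectors $\chi_1,\dots,\chi_N$ forming an orthonormal basis of $\mathbb{C}^N$. A signal $f:\mathcal V\to\mathbb{C}$ is identified with the vector $(f(1),\dots,f(N))\in\mathbb{C}^N$. The graph Fourier transform of $f\in\mathbb{C}^N$ is $\widehat f(\lambda_l)=\sum_{n=1}^N f(n)\overline{\chi_l(n)}$, $l=1,\dots,N$ (indexed by $l$), with inverse $f(n)=\sum_{l=1}^N\widehat f(\lambda_l)\chi_l(n)$. The generalized convolution is $(f\ast h)(n)=\sum_{l=1}^N \widehat f(\lambda_l)\widehat h(\lambda_l)\chi_l(n)$. For $i=1,\dots,N$, $\delta_i\in\mathbb{C}^N$ is given by $\delta_i(n)=1$ if $n=i$ and $0$ otherwise, and the generalized translation is $T_i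 f=\sqrt N\,(f\ast\delta_i)$. Given a function $\widehat g:\mathbb{C}\to\mathbb{C}$, the associated signal $g\in\mathbb{C}^N$ is the inverse graph Fourier transform of the restriction of $\widehat g$ to the spectrum of $A$, i.e. $g(n)=\sum_{l=1}^N\widehat g(\lambda_l)\chi_l(n)$. For $s\in\mathbb{C}$ the dilation $D_s g\in\mathbb{C}^N$ is the signal with graph Fourier transform $\widehat{D_s g}(\lambda_l)=\widehat g(s\lambda_l)$, $l=1,\dots,N$. A (finite, indexed) family $\{f_k\}$ in $\mathbb{C}^N$ is a frame for $\mathbb{C}^N$ with frame bounds $\alpha,\beta>0$ if $\alpha\|f\|^2\le\sum_k|\langle f,f_k\rangle|^2\le\beta\|f\|^2$ for all $f\in\mathbb{C}^N$. *)

theory Defs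
  imports "HOL-Analysis.Analysis"
begin

text \<open>
  The vertex set is a finite type \<^typ>\<open>'n\<close>, so \<open>N = CARD('n)\<close>; signals are vectors in
  \<^typ>\<open>complex ^ 'n\<close>. Eigenvalues and eigenvectors are families indexed by the same type, which
  lists the eigenvalues with multiplicity. A graph is given by its weight matrix; \<open>{i, j}\<close> is an
  edge iff the weight of \<open>(i, j)\<close> is positive.
\<close>

definition connected_weighted_graph :: "real ^ 'n ^ 'n \<Rightarrow> bool" where
  "connected_weighted_graph W \<longleftrightarrow>
     transpose W = W \<and> (\<forall>i j. 0 \<le> W $ i $ j) \<and>
     (\<forall>i j. (i, j) \<in> {(a, b). 0 < W $ a $ b}\<^sup>*)"

text \<open>
  The Hermitian inner product (the library's inner product on \<^typ>\<open>complex ^ 'n\<close> is its real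
  part). The library's \<^const>\<open>norm\<close> on this type is the norm it induces.
\<close>

definition hinner :: "complex ^ 'n \<Rightarrow> complex ^ 'n \<Rightarrow> complex" where
  "hinner f h = (\<Sum>n\<in>UNIV. f $ n * cnj (h $ n))"

definition orthonormal_basis :: "('n \<Rightarrow> complex ^ 'n) \<Rightarrow> bool" where
  "orthonormal_basis chi \<longleftrightarrow>
     (\<forall>l m. hinner (chi l) (chi m) = (if l = m then 1 else 0)) \<and>
     vec.span (range chi) = UNIV"

text \<open>
  \<open>A\<close> is diagonalizable, with eigenvalues \<open>lam\<close> and an orthonormal basis of eigenvectors \<open>chi\<close>.
\<close>

definition orthonormal_eigenbasis ::
    "complex ^ 'n ^ 'n \<Rightarrow> ('n \<Rightarrow> complex) \<Rightarrow> ('n \<Rightarrow> complex ^ 'n) \<Rightarrow> bool" where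
  "orthonormal_eigenbasis A lam chi \<longleftrightarrow>
     orthonormal_basis chi \<and> (\<forall>l. A *v chi l = lam l *s chi l)"

text \<open>The component \<open>gft chi f $ l\<close> is the graph Fourier coefficient of \<open>f\<close> at \<open>lam l\<close>; it is indexed by
  \<open>l\<close>, since eigenvalues may repeat.\<close>

definition gft :: "('n \<Rightarrow> complex ^ 'n) \<Rightarrow> complex ^ 'n \<Rightarrow> complex ^ 'n" where
  "gft chi f = (\<chi> l. \<Sum>n\<in>UNIV. f $ n * cnj (chi l $ n))"

definition igft :: "('n \<Rightarrow> complex ^ 'n) \<Rightarrow> complex ^ 'n \<Rightarrow> complex ^ 'n" where
  "igft chi F = (\<chi> n. \<Sum>l\<in>UNIV. F $ l * chi l $ n)"

definition gconv ::
    "('n \<Rightarrow> complex ^ 'n) \<Rightarrow> complex ^ 'n \<Rightarrow> complex ^ 'n \<Rightarrow> complex ^ 'n" where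
  "gconv chi f h = (\<chi> n. \<Sum>l\<in>UNIV. gft chi f $ l * gft chi h $ l * chi l $ n)"

text \<open>The unit signal at \<open>i\<close> is the library's \<open>axis i 1\<close>.\<close>

definition translation ::
    "('n \<Rightarrow> complex ^ 'n) \<Rightarrow> 'n \<Rightarrow> complex ^ 'n \<Rightarrow> complex ^ 'n" where
  "translation chi i f = sqrt (real CARD('n)) *\<^sub>R gconv chi f (axis i 1)"

definition assoc_signal ::
    "('n \<Rightarrow> complex) \<Rightarrow> ('n \<Rightarrow> complex ^ 'n) \<Rightarrow> (complex \<Rightarrow> complex) \<Rightarrow> complex ^ 'n" where
  "assoc_signal lam chi ghat = igft chi (\<chi> l. ghat (lam l))"

text \<open>
  The dilation of the signal associated with \<open>ghat\<close>. It takes \<open>ghat\<close> rather than that signal as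
  its argument, because the signal only determines \<open>ghat\<close> on the spectrum.
\<close>

definition dilation ::
    "('n \<Rightarrow> complex) \<Rightarrow> ('n \<Rightarrow> complex ^ 'n) \<Rightarrow> complex \<Rightarrow> (complex \<Rightarrow> complex) \<Rightarrow> complex ^ 'n"
  where
  "dilation lam chi s ghat = igft chi (\<chi> l. ghat (s * lam l))"

definition frame_with_bounds ::
    "'k set \<Rightarrow> ('k \<Rightarrow> complex ^ 'n) \<Rightarrow> real \<Rightarrow> real \<Rightarrow> bool" where
  "frame_with_bounds K F \<alpha> \<beta> \<longleftrightarrow>
     finite K \<and> 0 < \<alpha> \<and> 0 < \<beta> \<and>
     (\<forall>f. \<alpha> * (norm f)\<^sup>2 \<le> (\<Sum>k\<in>K. (cmod (hinner f (F k)))\<^sup>2) \<and>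
          (\<Sum>k\<in>K. (cmod (hinner f (F k)))\<^sup>2) \<le> \<beta> * (norm f)\<^sup>2)"

lemma gft_igft:
  assumes "orthonormal_basis chi"
  shows "gft chi (igft chi F) = F"
proof -
  have "gft chi (igft chi F) $ m = F $ m" for m
  proof -
    have "gft chi (igft chi F) $ m = (\<Sum>n\<in>UNIV. \<Sum>l\<in>UNIV. F $ l * chi l $ n * cnj (chi m $ n))"
      by (simp add: gft_def igft_def sum_distrib_right)
    also have "\<dots> = (\<Sum>l\<in>UNIV. F $ l * hinner (chi l) (chi m))"
      by (subst sum.swap) (simp add: hinner_def sum_distrib_left mult.assoc)
    also have "\<dots> = (\<Sum>l\<in>UNIV. if l = m then F $ l else 0)"
      using assms by (intro sum.cong) (auto simp: orthonormal_basis_def)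
    also have "\<dots> = F $ m" by simp
    finally show ?thesis .
  qed
  then show ?thesis by (simp add: vec_eq_iff)
qed

lemma gft_dilation:
  "orthonormal_basis chi \<Longrightarrow> gft chi (dilation lam chi s ghat) $ l = ghat (s * lam l)"
  by (simp add: dilation_def gft_igft)

lemma dilation_one: "dilation lam chi 1 ghat = assoc_signal lam chi ghat"
  by (simp add: dilation_def assoc_signal_def)

lemma hinner_self: "hinner f f = complex_of_real ((norm f)\<^sup>2)"
proof -
  have "complex_of_real ((norm f)\<^sup>2) = (\<Sum>n\<in>UNIV. complex_of_real ((cmod (f $ n))\<^sup>2))"
    by (simp only: norm_vec_def L2_set_def real_sqrt_pow2[OF sum_nonneg] zero_le_power2 of_real_sum)
  also have "\<dots> = hinner f f"
    by (simp only: hinner_def complex_norm_square)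
  finally show ?thesis by simp
qed

end

theory Submission
  imports Defs
begin

text \<open>
  With \<open>F = gft chi f\<close>, the inner product of \<open>f\<close> with the translate by \<open>i\<close> of the dilation by \<open>s\<close>
  is \<open>sqrt N\<close> times the value at \<open>i\<close> of the inverse transform of \<open>l \<mapsto> F $ l * cnj (ghat (s * lam l))\<close>.
  Summing over \<open>i\<close>, Parseval gives \<open>N * (\<Sum>l. \<bar>F $ l\<bar>\<^sup>2 * \<bar>ghat (s * lam l)\<bar>\<^sup>2)\<close>, so in the Fourier
  coordinates the frame operator is diagonal with entries \<open>N * (\<Sum>s\<in>J. \<bar>ghat (s * lam l)\<bar>\<^sup>2)\<close>, and the
  frame bounds are bounds on these entries.
\<close>

lemma norm_power2_vec_complex: "(norm (f :: complex ^ 'n))\<^sup>2 = (\<Sum>n\<in>UNIV. (cmod (f $ n))\<^sup>2)"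
  by (simp add: norm_vec_def L2_set_def sum_nonneg)

lemma hinner_igft: "hinner (igft chi F) h = (\<Sum>l\<in>UNIV. F $ l * hinner (chi l) h)"
  unfolding hinner_def igft_def
  by (simp add: sum_distrib_left sum_distrib_right mult.assoc) (rule sum.swap)

lemma gft_eq_hinner: "gft chi f $ l = hinner f (chi l)"
  by (simp add: gft_def hinner_def)

lemma cnj_hinner: "cnj (hinner f h) = hinner h f"
  by (simp add: hinner_def mult.commute)

text \<open>Parseval. Only the left factor of the inner product of \<open>igft chi F\<close> with
  itself is expanded; what remains against each \<open>chi l\<close> is a conjugated Fourier
  coefficient of \<open>igft chi F\<close>, which \<open>gft_igft\<close> identifies with
  \<open>cnj (F $ l)\<close>.\<close>

lemma norm_igft:
  assumes "orthonormal_basis chi"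
  shows "(norm (igft chi F))\<^sup>2 = (norm F)\<^sup>2"
proof -
  have "hinner (chi l) (igft chi F) = cnj (F $ l)" for l
    using gft_igft[OF assms, of F] by (metis cnj_hinner gft_eq_hinner)
  then have "hinner (igft chi F) (igft chi F) = hinner F F"
    by (simp add: hinner_igft) (simp add: hinner_def)
  then show ?thesis
    unfolding hinner_self of_real_eq_iff .
qed

text \<open>The range is a subspace containing every \<open>chi l\<close>, hence their span. This
  lets a statement about all signals be tested on signals given by their Fourier
  coefficients.\<close>

lemma surj_igft:
  assumes "orthonormal_basis chi"
  shows "surj (igft chi)"
proof -
  have "vec.subspace (range (igft chi))"
  proof (rule vec.subspaceI)
    have "igft chi 0 = 0" by (simp add: igft_def vec_eq_iff)
    then show "0 \<in> range (igft chi)" by (metis rangeI)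
  next
    fix x y assume "x \<in> range (igft chi)" "y \<in> range (igft chi)"
    then obtain F H where "x = igft chi F" "y = igft chi H" by blast
    then have "x + y = igft chi (F + H)"
      by (simp add: igft_def vec_eq_iff sum.distrib distrib_right)
    then show "x + y \<in> range (igft chi)" by blast
  next
    fix c x assume "x \<in> range (igft chi)"
    then obtain F where "x = igft chi F" by blast
    then have "c *s x = igft chi (c *s F)"
      by (simp add: igft_def vec_eq_iff sum_distrib_left mult.assoc)
    then show "c *s x \<in> range (igft chi)" by blast
  qed
  moreover have "igft chi (axis l 1) = chi l" for l
    by (simp add: igft_def vec_eq_iff axis_def if_distrib[of "\<lambda>x. x * _"] cong: if_cong)
  then have "range chi \<subseteq> range (igft chi)" by (metis image_subsetI rangeI)
  ultimately have "vec.span (range chi) \<subseteq> range (igft chi)"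
    by (rule vec.span_minimal[rotated])
  then show ?thesis
    using assms by (auto simp: orthonormal_basis_def)
qed

text \<open>The unit signal at \<open>i\<close> has Fourier coefficients
  \<open>cnj (chi l $ i)\<close>, and convolution multiplies coefficients.\<close>

lemma translation_dilation:
  fixes chi :: "'n \<Rightarrow> complex ^ 'n"
  assumes "orthonormal_basis chi"
  shows "translation chi i (dilation lam chi s ghat) =
    complex_of_real (sqrt (real CARD('n))) *s
      igft chi (\<chi> l. ghat (s * lam l) * cnj (chi l $ i))"
proof -
  have "gft chi (axis i 1) $ l = cnj (chi l $ i)" for l
    by (simp add: gft_def axis_def if_distrib[of "\<lambda>x. x * _"] cong: if_cong)
  then show ?thesis
    using gft_dilation[OF assms]
    by (simp add: translation_def gconv_def igft_def vec_eq_iff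
        scaleR_conv_of_real[where 'a = complex])
qed

text \<open>Stated as a value at \<open>i\<close> of one inverse transform independent of
  \<open>i\<close>, so that summing squared moduli over \<open>i\<close> yields a squared norm. The
  proof swaps the arguments, since \<open>hinner_igft\<close> expands the first one, and conjugates
  back.\<close>

lemma hinner_translation_dilation:
  fixes chi :: "'n \<Rightarrow> complex ^ 'n"
  assumes "orthonormal_basis chi"
  shows "hinner f (translation chi i (dilation lam chi s ghat)) =
    complex_of_real (sqrt (real CARD('n))) *
      igft chi (\<chi> l. gft chi f $ l * cnj (ghat (s * lam l))) $ i"
proof -
  have smult: "hinner (c *s h) f = c * hinner h f" for c and h :: "complex ^ 'n"
    by (simp add: hinner_def sum_distrib_left mult.assoc)
  have "hinner (translation chi i (dilation lam chi s ghat)) f =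
      complex_of_real (sqrt (real CARD('n))) *
        (\<Sum>l\<in>UNIV. ghat (s * lam l) * cnj (chi l $ i) * hinner (chi l) f)"
    by (simp add: translation_dilation[OF assms] smult hinner_igft)
  then have "cnj (hinner (translation chi i (dilation lam chi s ghat)) f) =
      complex_of_real (sqrt (real CARD('n))) *
        (\<Sum>l\<in>UNIV. cnj (ghat (s * lam l)) * chi l $ i * hinner f (chi l))"
    by (simp add: cnj_hinner)
  then show ?thesis
    by (simp add: cnj_hinner igft_def gft_eq_hinner mult_ac)
qed

lemma sum_translation_dilation:
  fixes chi :: "'n \<Rightarrow> complex ^ 'n"
  assumes "orthonormal_basis chi"
  shows "(\<Sum>i\<in>UNIV. (cmod (hinner f (translation chi i (dilation lam chi s ghat))))\<^sup>2) =
    real CARD('n) * (\<Sum>l\<in>UNIV. (cmod (gft chi f $ l))\<^sup>2 * (cmod (ghat (s * lam l)))\<^sup>2)"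
    (is "?L = ?R")
proof -
  have "?L = real CARD('n) *
      (norm (igft chi (\<chi> l. gft chi f $ l * cnj (ghat (s * lam l)))))\<^sup>2"
    by (simp add: hinner_translation_dilation[OF assms] norm_mult power_mult_distrib
        norm_power2_vec_complex sum_distrib_left)
  also have "\<dots> = ?R"
    by (simp add: norm_igft[OF assms]) (simp add: norm_power2_vec_complex norm_mult power_mult_distrib)
  finally show ?thesis .
qed

theorem corollary5p3:
  fixes W :: "real ^ 'n ^ 'n"
    and A :: "complex ^ 'n ^ 'n"
    and lam :: "'n \<Rightarrow> complex"
    and chi :: "'n \<Rightarrow> complex ^ 'n"
    and ghat :: "complex \<Rightarrow> complex"
    and J :: "real set"
    and \<alpha> \<beta> :: real
  assumes "connected_weighted_graph W"
    and "orthonormal_eigenbasis A lam chi"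
    and "finite J" and "J \<subseteq> {0<..}"
    and "0 < \<alpha>" and "0 < \<beta>"
  shows "frame_with_bounds (UNIV \<times> J)
           (\<lambda>(i, s). translation chi i (dilation lam chi (complex_of_real s) ghat)) \<alpha> \<beta>
         \<longleftrightarrow>
         (\<forall>l. \<alpha> / real CARD('n) \<le> (\<Sum>s\<in>J. (cmod (ghat (complex_of_real s * lam l)))\<^sup>2) \<and>
              (\<Sum>s\<in>J. (cmod (ghat (complex_of_real s * lam l)))\<^sup>2) \<le> \<beta> / real CARD('n))"
proof -
  let ?S = "\<lambda>l. \<Sum>s\<in>J. (cmod (ghat (complex_of_real s * lam l)))\<^sup>2"
  let ?T = "\<lambda>(i, s). translation chi i (dilation lam chi (complex_of_real s) ghat)"
  let ?N = "real CARD('n)"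
  have ob: "orthonormal_basis chi"
    using assms(2) by (simp add: orthonormal_eigenbasis_def)
  \<comment> \<open>Writing the signal as \<open>igft chi F\<close> makes its Fourier coefficients
    the free variable \<open>F\<close>, which exhibits the diagonal form.\<close>
  have frame_sum: "(\<Sum>k\<in>UNIV \<times> J. (cmod (hinner (igft chi F) (?T k)))\<^sup>2) =
      (\<Sum>l\<in>UNIV. ?N * ?S l * (cmod (F $ l))\<^sup>2)" for F
  proof -
    have "(\<Sum>k\<in>UNIV \<times> J. (cmod (hinner (igft chi F) (?T k)))\<^sup>2) =
        (\<Sum>s\<in>J. \<Sum>i\<in>UNIV. (cmod (hinner (igft chi F) (?T (i, s))))\<^sup>2)"
      by (subst sum.swap) (simp add: sum.cartesian_product case_prod_beta)
    also have "\<dots> = (\<Sum>s\<in>J. \<Sum>l\<in>UNIV.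
        ?N * ((cmod (F $ l))\<^sup>2 * (cmod (ghat (complex_of_real s * lam l)))\<^sup>2))"
      by (simp add: sum_translation_dilation[OF ob] gft_igft[OF ob] sum_distrib_left)
    also have "\<dots> = (\<Sum>l\<in>UNIV. ?N * ?S l * (cmod (F $ l))\<^sup>2)"
      by (subst sum.swap) (simp add: sum_distrib_left sum_distrib_right mult_ac)
    finally show ?thesis .
  qed
  have "frame_with_bounds (UNIV \<times> J) ?T \<alpha> \<beta> \<longleftrightarrow>
      (\<forall>F. \<alpha> * (norm F)\<^sup>2 \<le> (\<Sum>l\<in>UNIV. ?N * ?S l * (cmod (F $ l))\<^sup>2) \<and>
           (\<Sum>l\<in>UNIV. ?N * ?S l * (cmod (F $ l))\<^sup>2) \<le> \<beta> * (norm F)\<^sup>2)"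
    (is "_ \<longleftrightarrow> (\<forall>F. ?B F)")
  proof -
    \<comment> \<open>Surjectivity of \<open>igft chi\<close> replaces all signals by its range, so
      the quantifier can pass to \<open>F\<close>; Parseval then turns the norm of the signal into
      that of \<open>F\<close>.\<close>
    have "frame_with_bounds (UNIV \<times> J) ?T \<alpha> \<beta> \<longleftrightarrow>
      (\<forall>f\<in>range (igft chi). \<alpha> * (norm f)\<^sup>2 \<le> (\<Sum>k\<in>UNIV \<times> J. (cmod (hinner f (?T k)))\<^sup>2) \<and>
          (\<Sum>k\<in>UNIV \<times> J. (cmod (hinner f (?T k)))\<^sup>2) \<le> \<beta> * (norm f)\<^sup>2)"
      unfolding frame_with_bounds_def surj_igft[OF ob] using assms by simp
    then show ?thesis
      by (simp only: ball_simps frame_sum norm_igft[OF ob] UNIV_I simp_thms)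
  qed
  also have "\<dots> \<longleftrightarrow> (\<forall>l. \<alpha> \<le> ?N * ?S l \<and> ?N * ?S l \<le> \<beta>)"
  proof (intro iffI allI)
    fix l assume "\<forall>F. ?B F"
    \<comment> \<open>This unit vector has norm 1 and picks out the \<open>l\<close>-th diagonal
      entry.\<close>
    then have "?B (axis l 1)" by blast
    moreover have "(\<Sum>m\<in>UNIV. ?N * ?S m * (cmod (axis l 1 $ m))\<^sup>2) = ?N * ?S l"
      by (simp add: axis_def if_distrib[of cmod] if_distrib[of "\<lambda>x. x\<^sup>2"]
          if_distrib[of "\<lambda>x. _ * x"] cong: if_cong)
    ultimately show "\<alpha> \<le> ?N * ?S l \<and> ?N * ?S l \<le> \<beta>" by simp
  next
    fix F :: "complex ^ 'n"
    assume "\<forall>l. \<alpha> \<le> ?N * ?S l \<and> ?N * ?S l \<le> \<beta>"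
    then show "?B F"
      \<comment> \<open>Conversely, the bounds on the entries are weighted by
        \<open>(cmod (F $ l))\<^sup>2\<close> and summed termwise.\<close>
      unfolding norm_power2_vec_complex sum_distrib_left
      by (intro conjI sum_mono mult_right_mono) auto
  qed
  also have "\<dots> \<longleftrightarrow> (\<forall>l. \<alpha> / ?N \<le> ?S l \<and> ?S l \<le> \<beta> / ?N)"
    by (simp add: pos_divide_le_eq pos_le_divide_eq mult.commute)
  finally show ?thesis .
qed

end
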